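(* For every integer $d\ge 0$: (a) $\tilde{A}_d\subseteq\tilde{A}_k$ for each $0\le k\le d$; in particular $\tilde{A}_d\subseteq\tilde{A}_0$ and $\tilde{A}_{d+1}\subseteq\tilde{A}_d$. (b) $\tilde{A}_d=\tilde{A}_0\cap\hat{A}_d$.
   Context: All sequences are finite words $\alpha=a_1\ldots a_n$ ($n\ge0$) of positive integers. For an integer $d\ge 0$, an index $i\in[n]$ is a $d$-ascent of $\alpha$ if $i=1$, or $i\ge 2$ and $a_i>a_{i-1}-d$; $\mathrm{asc}_d\alpha$ is the number of $d$-ascents. $\alpha$ is a $d$-ascent sequence if $a_i\le1+\mathrm{asc}_d(a_1\ldots a_{i-1})$ for all $i\in[n]$; $A_d$ is the set of all $d$-ascent sequences. For a word $\alpha$ and index $j$, $M(\alpha,j)$ adds $1$ to every $a_i$ with $i<j$ and $a_i\ge a_j$; $M(\alpha,j_1,\dots,j_k)=M(M(\alpha,j_1,\dots,j_{k-1}),j_k)$. For $\alpha\in A_d$, $\mathrm{hat}_d(\alpha)=M(\alpha,j_1,\dots,j_k)$ with $j_1<\dots<j_k$ the $d$-ascents of $\alpha$. $\hat{A}_d=\{\mathrm{hat}_d(\alpha):\alpha\in A_d\}$ and $\tilde{A}_d=\{\alpha\in A_d:\mathrm{hat}_d(\alpha)=\alpha\}$. *)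

theory Defs
  imports Main
begin

text \<open>
  Words are lists of positive integers, represented as \<open>nat list\<close> with an explicit positivity
  condition. Positions are counted from 0, so the mathematical index \<open>i\<close> in \<open>{1..n}\<close> is the list
  position \<open>i - 1\<close>.
\<close>

text \<open>
  The condition \<open>\<alpha>\<^sub>i > \<alpha>\<^sub>i\<^sub>-\<^sub>1 - d\<close> is meant over the integers; it is written additively to avoid
  truncated subtraction on \<open>nat\<close>.
\<close>

definition d_ascents :: "nat \<Rightarrow> nat list \<Rightarrow> nat set" where
  "d_ascents d \<alpha> = {i. i < length \<alpha> \<and> (i = 0 \<or> \<alpha> ! i + d > \<alpha> ! (i - 1))}"

definition asc :: "nat \<Rightarrow> nat list \<Rightarrow> nat" where
  "asc d \<alpha> = card (d_ascents d \<alpha>)"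

definition ascent_seqs :: "nat \<Rightarrow> nat list set" where
  "ascent_seqs d = {\<alpha>. (\<forall>a \<in> set \<alpha>. a > 0) \<and>
                       (\<forall>i < length \<alpha>. \<alpha> ! i \<le> 1 + asc d (take i \<alpha>))}"

definition raise_at :: "nat list \<Rightarrow> nat \<Rightarrow> nat list" where
  "raise_at \<alpha> j =
     map (\<lambda>i. if i < j \<and> \<alpha> ! i \<ge> \<alpha> ! j then \<alpha> ! i + 1 else \<alpha> ! i) [0..<length \<alpha>]"

text \<open>\<open>raise_list \<alpha> [j\<^sub>1, \<dots>, j\<^sub>k]\<close> is \<open>M(\<alpha>, j\<^sub>1, \<dots>, j\<^sub>k)\<close>; the position \<open>j\<^sub>1\<close> is processed first.\<close>

definition raise_list :: "nat list \<Rightarrow> nat list \<Rightarrow> nat list" where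
  "raise_list \<alpha> js = foldl raise_at \<alpha> js"

text \<open>The positions are the \<open>d\<close>-ascents of the original word, in increasing order.\<close>

definition hat :: "nat \<Rightarrow> nat list \<Rightarrow> nat list" where
  "hat d \<alpha> = raise_list \<alpha> (sorted_list_of_set (d_ascents d \<alpha>))"

definition modified_seqs :: "nat \<Rightarrow> nat list set" where
  "modified_seqs d = hat d ` ascent_seqs d"

definition self_modified_seqs :: "nat \<Rightarrow> nat list set" where
  "self_modified_seqs d = {\<alpha> \<in> ascent_seqs d. hat d \<alpha> = \<alpha>}"

end

theory Submission
  imports Defs
begin

text \<open>
  Appending a letter \<open>b\<close> to \<open>\<alpha>\<close> changes \<open>hat d \<alpha>\<close> in a simple way: if \<open>b\<close> creates a
  \<open>d\<close>-ascent, all letters \<open>\<ge> b\<close> are raised by one, and then \<open>b\<close> is appended. Hence a word is fixed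
  by \<open>hat d\<close> iff each of its \<open>d\<close>-ascents is a strict left-to-right maximum; for such words the
  \<open>k\<close>-ascents with \<open>k \<le> d\<close> coincide with the \<open>d\<close>-ascents, which gives (a). For (b), the letters of
  \<open>hat d \<beta>\<close> are exactly \<open>1, \<dots>, asc d \<beta>\<close>. If \<open>hat d (\<beta> b)\<close> lies in \<open>self_modified_seqs 0\<close>, its
  prefix obtained by deleting \<open>b\<close> does too, so the letters of that prefix also form an initial
  segment; as \<open>b\<close> is missing from it when \<open>b\<close> is a \<open>d\<close>-ascent, nothing was raised. By induction
  \<open>hat d \<beta> = \<beta>\<close>.
\<close>

text \<open>Decides whether \<open>b\<close>, appended to \<open>\<alpha>\<close>, stands at a
  \<open>d\<close>-ascent; using \<open>last\<close> keeps list positions out of the inductions by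
  appending a letter.\<close>

definition new_ascent :: "nat \<Rightarrow> nat list \<Rightarrow> nat \<Rightarrow> bool" where
  "new_ascent d \<alpha> b \<longleftrightarrow> \<alpha> = [] \<or> last \<alpha> < b + d"

definition raise_letter :: "nat \<Rightarrow> nat \<Rightarrow> nat" where
  "raise_letter b x = (if b \<le> x then x + 1 else x)"

lemma finite_d_ascents [simp]: "finite (d_ascents d \<alpha>)"
  by (simp add: d_ascents_def)

lemma d_ascents_Nil [simp]: "d_ascents d [] = {}"
  by (simp add: d_ascents_def)

lemma asc_Nil [simp]: "asc d [] = 0"
  by (simp add: asc_def)

lemma hat_Nil [simp]: "hat d [] = []"
  by (simp add: hat_def raise_list_def)

lemma d_ascents_less_length: "i \<in> d_ascents d \<alpha> \<Longrightarrow> i < length \<alpha>"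
  by (simp add: d_ascents_def)

lemma length_notin_d_ascents [simp]: "length \<alpha> \<notin> d_ascents d \<alpha>"
  by (simp add: d_ascents_def)

lemma d_ascents_snoc:
  "d_ascents d (\<alpha> @ [b]) = d_ascents d \<alpha> \<union> (if new_ascent d \<alpha> b then {length \<alpha>} else {})"
  by (cases "\<alpha> = []")
     (auto simp: d_ascents_def new_ascent_def nth_append last_conv_nth less_Suc_eq)

lemma asc_snoc: "asc d (\<alpha> @ [b]) = asc d \<alpha> + (if new_ascent d \<alpha> b then 1 else 0)"
  by (simp add: asc_def d_ascents_snoc)

lemma length_raise_at [simp]: "length (raise_at \<alpha> j) = length \<alpha>"
  by (simp add: raise_at_def)

lemma length_raise_list [simp]: "length (raise_list \<alpha> js) = length \<alpha>"
  by (induction js arbitrary: \<alpha>) (simp_all add: raise_list_def)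

lemma raise_at_snoc: "j < length \<alpha> \<Longrightarrow> raise_at (\<alpha> @ [b]) j = raise_at \<alpha> j @ [b]"
  by (auto simp: raise_at_def nth_append)

lemma raise_at_length_snoc: "raise_at (\<alpha> @ [b]) (length \<alpha>) = map (raise_letter b) \<alpha> @ [b]"
  by (auto simp: raise_at_def raise_letter_def nth_append intro: nth_equalityI)

lemma raise_list_snoc:
  "\<forall>j \<in> set js. j < length \<alpha> \<Longrightarrow> raise_list (\<alpha> @ [b]) js = raise_list \<alpha> js @ [b]"
  by (induction js arbitrary: \<alpha>) (simp_all add: raise_list_def raise_at_snoc)

text \<open>Old \<open>d\<close>-ascents lie before \<open>b\<close>, so processing them neither
  reads nor changes it; a new one has the largest position and is therefore processed last.\<close>

lemma hat_snoc:
  "hat d (\<alpha> @ [b]) =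
     (if new_ascent d \<alpha> b then map (raise_letter b) (hat d \<alpha>) else hat d \<alpha>) @ [b]"
proof -
  let ?js = "sorted_list_of_set (d_ascents d \<alpha>)"
  have old: "raise_list (\<alpha> @ [b]) ?js = hat d \<alpha> @ [b]"
    by (simp add: raise_list_snoc d_ascents_less_length hat_def)
  have "sorted_list_of_set (d_ascents d (\<alpha> @ [b])) =
      ?js @ (if new_ascent d \<alpha> b then [length \<alpha>] else [])"
    by (rule sorted_list_of_set_unique[THEN iffD1])
       (auto simp: d_ascents_snoc sorted_wrt_append dest: d_ascents_less_length)
  moreover have "length (hat d \<alpha>) = length \<alpha>"
    by (simp add: hat_def)
  ultimately show ?thesis
    using old raise_at_length_snoc[of "hat d \<alpha>" b]
    by (simp add: hat_def[of d "\<alpha> @ [b]"] raise_list_def)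
qed

lemma ascent_seqs_Nil [simp]: "[] \<in> ascent_seqs d"
  by (simp add: ascent_seqs_def)

lemma ascent_seqs_snoc:
  "\<alpha> @ [b] \<in> ascent_seqs d \<longleftrightarrow> \<alpha> \<in> ascent_seqs d \<and> 0 < b \<and> b \<le> 1 + asc d \<alpha>"
  by (auto simp: ascent_seqs_def nth_append less_Suc_eq)

lemma le_hat: "list_all2 (\<le>) \<alpha> (hat d \<alpha>)"
proof (induction \<alpha> rule: rev_induct)
  case (snoc b \<alpha>)
  then have "list_all2 (\<le>) \<alpha> (map (raise_letter b) (hat d \<alpha>))"
    by (auto simp: raise_letter_def list_all2_conv_all_nth intro: le_SucI)
  with snoc show ?case
    by (simp add: hat_snoc list_all2_appendI)
qed simp

lemma hat_eq_snoc:
  "hat d (\<alpha> @ [b]) = \<alpha> @ [b] \<longleftrightarrow>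
     hat d \<alpha> = \<alpha> \<and> (new_ascent d \<alpha> b \<longrightarrow> (\<forall>x \<in> set \<alpha>. x < b))"
proof -
  have "map (raise_letter b) (hat d \<alpha>) = \<alpha> \<longleftrightarrow> hat d \<alpha> = \<alpha> \<and> (\<forall>x \<in> set \<alpha>. x < b)"
  proof
    assume eq: "map (raise_letter b) (hat d \<alpha>) = \<alpha>"
    \<comment> \<open>Letterwise sandwich: \<open>\<alpha>\<close> \<le>
      \<open>hat d \<alpha>\<close> \<le> raised word = \<open>\<alpha>\<close>, so no raise can be
      undone later.\<close>
    have "list_all2 (\<le>) (hat d \<alpha>) (map (raise_letter b) (hat d \<alpha>))"
      by (simp add: raise_letter_def list_all2_conv_all_nth)
    then have "hat d \<alpha> = \<alpha>"
      using le_hat[of \<alpha> d] eq list_all2_antisym[of "(\<le>)" "(\<le>)" "hat d \<alpha>" \<alpha>]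
      by (simp add: list.rel_eq)
    moreover from this eq have "raise_letter b x = x" if "x \<in> set \<alpha>" for x
      using that by (metis map_eq_conv map_ident)
    ultimately show "hat d \<alpha> = \<alpha> \<and> (\<forall>x \<in> set \<alpha>. x < b)"
      by (metis add_eq_self_zero not_less one_neq_zero raise_letter_def)
  next
    assume "hat d \<alpha> = \<alpha> \<and> (\<forall>x \<in> set \<alpha>. x < b)"
    then show "map (raise_letter b) (hat d \<alpha>) = \<alpha>"
      by (auto simp: raise_letter_def intro!: map_idI)
  qed
  then show ?thesis
    by (simp add: hat_snoc)
qed

lemma self_modified_seqs_snoc:
  "\<alpha> @ [b] \<in> self_modified_seqs d \<longleftrightarrow>
     \<alpha> \<in> self_modified_seqs d \<and> 0 < b \<and> b \<le> 1 + asc d \<alpha> \<and>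
     (new_ascent d \<alpha> b \<longrightarrow> (\<forall>x \<in> set \<alpha>. x < b))"
  by (auto simp: self_modified_seqs_def ascent_seqs_snoc hat_eq_snoc)

text \<open>Equality of the ascent counts is carried through the induction because it transfers the
  bound \<open>b \<le> 1 + asc d \<alpha>\<close> to \<open>k\<close>.\<close>

lemma self_modified_seqs_antimono_asc:
  assumes "k \<le> d" and "\<alpha> \<in> self_modified_seqs d"
  shows "\<alpha> \<in> self_modified_seqs k \<and> asc k \<alpha> = asc d \<alpha>"
  using assms(2)
proof (induction \<alpha> rule: rev_induct)
  case Nil
  then show ?case by (simp add: self_modified_seqs_def)
next
  case (snoc b \<alpha>)
  from snoc.prems have "new_ascent d \<alpha> b \<longrightarrow> (\<forall>x \<in> set \<alpha>. x < b)"
    by (simp add: self_modified_seqs_snoc)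
  \<comment> \<open>A \<open>d\<close>-ascent \<open>b\<close> exceeds all earlier letters, in
    particular the last, so it is a \<open>k\<close>-ascent; the converse follows from
    \<open>k \<le> d\<close>.\<close>
  then have "new_ascent k \<alpha> b \<longleftrightarrow> new_ascent d \<alpha> b"
    using \<open>k \<le> d\<close> last_in_set[of \<alpha>] by (fastforce simp: new_ascent_def)
  with snoc show ?case
    by (simp add: self_modified_seqs_snoc asc_snoc)
qed

lemma self_modified_seqs_antimono:
  "k \<le> d \<Longrightarrow> self_modified_seqs d \<subseteq> self_modified_seqs k"
  using self_modified_seqs_antimono_asc by blast

lemma last_hat: "\<alpha> \<noteq> [] \<Longrightarrow> last (hat d \<alpha>) = last \<alpha>"
  by (cases \<alpha> rule: rev_cases) (simp_all add: hat_snoc)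

lemma hat_eq_Nil_iff: "hat d \<alpha> = [] \<longleftrightarrow> \<alpha> = []"
  by (cases \<alpha> rule: rev_cases) (simp_all add: hat_snoc)

text \<open>Letters below \<open>b\<close> stay and the others move up by one, which leaves a gap
  exactly at \<open>b\<close>; for \<open>b = Suc m\<close> nothing moves.\<close>

lemma image_raise_letter:
  assumes "0 < b" and "b \<le> Suc m"
  shows "raise_letter b ` {1..m} = {1..Suc m} - {b}"
proof (intro equalityI subsetI)
  fix y assume y: "y \<in> {1..Suc m} - {b}"
  then have "y = raise_letter b (if y < b then y else y - 1)"
    by (auto simp: raise_letter_def)
  moreover have "(if y < b then y else y - 1) \<in> {1..m}"
    using y assms by auto
  ultimately show "y \<in> raise_letter b ` {1..m}"
    by blast
qed (use assms in \<open>auto simp: raise_letter_def split: if_splits\<close>)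

text \<open>A new ascent \<open>b\<close> fills the gap that raising has just opened at
  \<open>b\<close>.\<close>

lemma set_hat:
  "\<alpha> \<in> ascent_seqs d \<Longrightarrow> set (hat d \<alpha>) = {1..asc d \<alpha>}"
proof (induction \<alpha> rule: rev_induct)
  case (snoc b \<alpha>)
  then have IH: "set (hat d \<alpha>) = {1..asc d \<alpha>}" and b: "0 < b" "b \<le> Suc (asc d \<alpha>)"
    by (simp_all add: ascent_seqs_snoc)
  show ?case
  proof (cases "new_ascent d \<alpha> b")
    case True
    then show ?thesis
      using b IH image_raise_letter[OF b] by (auto simp: hat_snoc asc_snoc)
  next
    case False
    \<comment> \<open>A letter that is no \<open>d\<close>-ascent is at most the last letter, which
      \<open>hat d\<close> preserves, so it already lies in the segment.\<close>
    then have "\<alpha> \<noteq> []" "b \<le> last (hat d \<alpha>)"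
      by (auto simp: new_ascent_def last_hat)
    then have "b \<le> asc d \<alpha>"
      using IH last_in_set[of "hat d \<alpha>"] by (simp add: hat_eq_Nil_iff)
    with False b IH show ?thesis
      by (auto simp: hat_snoc asc_snoc)
  qed
qed simp

lemma hat_eq_if_self_modified:
  assumes "\<beta> \<in> ascent_seqs d" and "hat d \<beta> \<in> self_modified_seqs k"
  shows "hat d \<beta> = \<beta>"
  using assms
proof (induction \<beta> rule: rev_induct)
  case (snoc b \<beta>)
  then have \<beta>: "\<beta> \<in> ascent_seqs d" and b: "0 < b" "b \<le> Suc (asc d \<beta>)"
    by (simp_all add: ascent_seqs_snoc)
  show ?case
  proof (cases "new_ascent d \<beta> b")
    case True
    let ?\<gamma> = "map (raise_letter b) (hat d \<beta>)"
    have \<gamma>: "?\<gamma> \<in> self_modified_seqs k"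
      using snoc.prems True by (simp add: hat_snoc self_modified_seqs_snoc)
    \<comment> \<open>\<open>?\<gamma>\<close> is its own image under \<open>hat k\<close>, so its
      letters too form an initial segment.\<close>
    then have "set ?\<gamma> = {1..asc k ?\<gamma>}"
      using set_hat[of ?\<gamma> k] by (simp add: self_modified_seqs_def)
    moreover have "set ?\<gamma> = {1..Suc (asc d \<beta>)} - {b}"
      using image_raise_letter[OF b] set_hat[OF \<beta>] by simp
    ultimately have seg: "{1..Suc (asc d \<beta>)} - {b} = {1..asc k ?\<gamma>}"
      by simp
    have "b = Suc (asc d \<beta>)"
    proof (rule ccontr)
      \<comment> \<open>The top letter would survive the removal of \<open>b\<close>, and an initial
        segment reaching it would contain \<open>b\<close>.\<close>
      assume "b \<noteq> Suc (asc d \<beta>)"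
      then have "Suc (asc d \<beta>) \<in> {1..asc k ?\<gamma>}"
        unfolding seg[symmetric] by simp
      then have "b \<in> {1..asc k ?\<gamma>}"
        using b by simp
      then show False
        unfolding seg[symmetric] by simp
    qed
    \<comment> \<open>All letters of \<open>hat d \<beta>\<close> are at most
      \<open>asc d \<beta>\<close>, hence below \<open>b\<close>; raising is trivial and the
      induction hypothesis applies.\<close>
    then have "?\<gamma> = hat d \<beta>" and less: "\<forall>x \<in> set (hat d \<beta>). x < b"
      using set_hat[OF \<beta>] by (auto simp: raise_letter_def intro!: map_idI)
    with \<gamma> snoc.IH[OF \<beta>] have "hat d \<beta> = \<beta>"
      by simp
    with less show ?thesis
      by (simp add: hat_eq_snoc)
  next
    case False
    then show ?thesis
      using snoc \<beta> by (simp add: hat_snoc self_modified_seqs_snoc)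
  qed
qed simp

lemma self_modified_seqs_eq_Int:
  "self_modified_seqs d = self_modified_seqs 0 \<inter> modified_seqs d"
proof (intro equalityI subsetI)
  fix \<alpha> assume \<alpha>: "\<alpha> \<in> self_modified_seqs d"
  then have "\<alpha> \<in> modified_seqs d"
    by (force simp: self_modified_seqs_def modified_seqs_def)
  with \<alpha> self_modified_seqs_antimono[of 0 d]
  show "\<alpha> \<in> self_modified_seqs 0 \<inter> modified_seqs d"
    by blast
next
  fix \<alpha> assume "\<alpha> \<in> self_modified_seqs 0 \<inter> modified_seqs d"
  then obtain \<beta> where "\<beta> \<in> ascent_seqs d" "\<alpha> = hat d \<beta>" "hat d \<beta> \<in> self_modified_seqs 0"
    by (auto simp: modified_seqs_def)
  with hat_eq_if_self_modified[of \<beta> d 0] show "\<alpha> \<in> self_modified_seqs d"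
    by (simp add: self_modified_seqs_def)
qed

theorem theorem3p5:
  fixes d :: nat
  shows "(\<forall>k. 0 \<le> k \<and> k \<le> d \<longrightarrow> self_modified_seqs d \<subseteq> self_modified_seqs k)
    \<and> self_modified_seqs d \<subseteq> self_modified_seqs 0
    \<and> self_modified_seqs (d + 1) \<subseteq> self_modified_seqs d
    \<and> self_modified_seqs d = self_modified_seqs 0 \<inter> modified_seqs d"
  by (intro conjI allI impI self_modified_seqs_antimono self_modified_seqs_eq_Int) simp_all

end
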